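(* The function $d_{\mathrm{uni}}$ is a pseudometric on $\mathcal B_{(0,1]}$, i.e. it satisfies all axioms of a metric except for positive definiteness (it is non-negative, $d_{\mathrm{uni}}(R,R)=0$, symmetric, and satisfies the triangle inequality). Moreover, for $R,\widetilde R\in\mathcal B_{(0,1]}$ acting in $\mathcal H$ and $\widetilde{\mathcal H}$ respectively, $d_{\mathrm{uni}}(R,\widetilde R)=0$ is equivalent to the existence of a sequence of unitary operators $U_n\colon\mathcal H\to\widetilde{\mathcal H}$ such that $$\|\widetilde R-U_nRU_n^*\|\to 0\qquad\text{as } n\to\infty.$$ Finally, if $R$ and $\widetilde R$ are unitarily equivalent, then $d_{\mathrm{uni}}(R,\widetilde R)=0$.
   Context: Let $\mathsf{HS}$ be a fixed set of separable infinite-dimensional Hilbert spaces. For a Hilbert space $\mathcal H$, let $\mathcal B_{(0,1]}(\mathcal H)$ be the set of all bounded self-adjoint injective operators $R\colon\mathcal H\to\mathcal H$ with spectrum contained in $[0,1]$. Set $\mathcal B_{(0,1]}:=\bigcup_{\mathcal H\in\mathsf{HS}}\mathcal B_{(0,1]}(\mathcal H)$. For $R\in\mathcal B_{(0,1]}(\mathcal H)$ and $\widetilde R\in\mathcal B_{(0,1]}(\widetilde{\mathcal H})$ with $\mathcal H,\widetilde{\mathcal H}\in\mathsf{HS}$, define $$d_{\mathrm{uni}}(R,\widetilde R):=\inf\{\|\widetilde R-URU^*\| : U\colon\mathcal H\to\widetilde{\mathcal H}\text{ unitary}\},$$ where $\|\cdot\|$ is the operator norm. $R$ and $\widetilde R$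 are unitarily equivalent if $\widetilde R=URU^*$ for some unitary $U\colon\mathcal H\to\widetilde{\mathcal H}$. *)

theory Defs
  imports "HOL-Analysis.Analysis" "HOL-Algebra.Algebraic_Closure_Type"
begin

section \<open>Hilbert spaces with explicit carrier\<close>

text \<open>
  The statement quantifies over a set of different Hilbert spaces, so Hilbert spaces are
  records with a carrier rather than types. All scalars are complex. The fields
  \<open>mult\<close> and \<open>one\<close> inherited from the module record of HOL-Algebra are not used.
\<close>

record 'a inner_space = "(complex, 'a) module" +
  ip :: "'a \<Rightarrow> 'a \<Rightarrow> complex"

definition hnorm :: "'a inner_space \<Rightarrow> 'a \<Rightarrow> real" where
  "hnorm H x = sqrt (Re (ip H x x))"

text \<open>The value 0 off the carrier is needed because \<open>Metric_space\<close> requires symmetry and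
  non-negativity of the distance on the whole type.\<close>

definition hdist :: "'a inner_space \<Rightarrow> 'a \<Rightarrow> 'a \<Rightarrow> real" where
  "hdist H x y = (if x \<in> carrier H \<and> y \<in> carrier H then hnorm H (x \<ominus>\<^bsub>H\<^esub> y) else 0)"

locale inner_product_space =
  Module.module "ring_of_type_algebra :: complex ring" H for H :: "'a inner_space" (structure) +
  assumes ip_add_left:
      "\<lbrakk>x \<in> carrier H; y \<in> carrier H; z \<in> carrier H\<rbrakk> \<Longrightarrow> ip H (x \<oplus> y) z = ip H x z + ip H y z"
    and ip_smult_left:
      "\<lbrakk>x \<in> carrier H; y \<in> carrier H\<rbrakk> \<Longrightarrow> ip H (c \<odot> x) y = c * ip H x y"
    and ip_commute:
      "\<lbrakk>x \<in> carrier H; y \<in> carrier H\<rbrakk> \<Longrightarrow> ip H x y = cnj (ip H y x)"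
    and ip_pos:
      "\<lbrakk>x \<in> carrier H; x \<noteq> \<zero>\<rbrakk> \<Longrightarrow> 0 < Re (ip H x x)"

locale hilbert_space = inner_product_space +
  assumes complete: "Metric_space.mcomplete (carrier H) (hdist H)"

definition separable :: "'a inner_space \<Rightarrow> bool" where
  "separable H \<longleftrightarrow> separable_space (Metric_space.mtopology (carrier H) (hdist H))"

definition finite_dimensional :: "'a inner_space \<Rightarrow> bool" where
  "finite_dimensional H \<longleftrightarrow>
     (\<exists>B. finite B \<and> B \<subseteq> carrier H \<and>
        (\<forall>x\<in>carrier H. \<exists>c. x = (\<Oplus>\<^bsub>H\<^esub>b\<in>B. c b \<odot>\<^bsub>H\<^esub> b)))"

definition sep_inf_dim_hilbert_space :: "'a inner_space \<Rightarrow> bool" where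
  "sep_inf_dim_hilbert_space H \<longleftrightarrow> hilbert_space H \<and> separable H \<and> \<not> finite_dimensional H"

section \<open>Operators\<close>

text \<open>Operators are extensional functions on the carrier (\<open>undefined\<close> elsewhere), so that
  equality of functions is equality of operators.\<close>

definition bounded_ops :: "'a inner_space \<Rightarrow> 'a inner_space \<Rightarrow> ('a \<Rightarrow> 'a) set" where
  "bounded_ops H K = {A \<in> carrier H \<rightarrow>\<^sub>E carrier K.
     (\<forall>x\<in>carrier H. \<forall>y\<in>carrier H. A (x \<oplus>\<^bsub>H\<^esub> y) = A x \<oplus>\<^bsub>K\<^esub> A y) \<and>
     (\<forall>c. \<forall>x\<in>carrier H. A (c \<odot>\<^bsub>H\<^esub> x) = c \<odot>\<^bsub>K\<^esub> A x) \<and>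
     (\<exists>C. \<forall>x\<in>carrier H. hnorm K (A x) \<le> C * hnorm H x)}"

definition opnorm :: "'a inner_space \<Rightarrow> 'a inner_space \<Rightarrow> ('a \<Rightarrow> 'a) \<Rightarrow> real" where
  "opnorm H K A = (SUP x\<in>{x \<in> carrier H. hnorm H x \<le> 1}. hnorm K (A x))"

definition op_diff :: "'a inner_space \<Rightarrow> 'a inner_space \<Rightarrow> ('a \<Rightarrow> 'a) \<Rightarrow> ('a \<Rightarrow> 'a) \<Rightarrow> 'a \<Rightarrow> 'a" where
  "op_diff H K A B = (\<lambda>x\<in>carrier H. A x \<ominus>\<^bsub>K\<^esub> B x)"

definition op_scalar :: "'a inner_space \<Rightarrow> complex \<Rightarrow> 'a \<Rightarrow> 'a" where
  "op_scalar H c = (\<lambda>x\<in>carrier H. c \<odot>\<^bsub>H\<^esub> x)"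

definition adj :: "'a inner_space \<Rightarrow> 'a inner_space \<Rightarrow> ('a \<Rightarrow> 'a) \<Rightarrow> 'a \<Rightarrow> 'a" where
  "adj H K A = (\<lambda>y\<in>carrier K.
     THE z. z \<in> carrier H \<and> (\<forall>x\<in>carrier H. ip K (A x) y = ip H x z))"

definition self_adjoint :: "'a inner_space \<Rightarrow> ('a \<Rightarrow> 'a) \<Rightarrow> bool" where
  "self_adjoint H R \<longleftrightarrow> adj H H R = R"

definition spectrum :: "'a inner_space \<Rightarrow> ('a \<Rightarrow> 'a) \<Rightarrow> complex set" where
  "spectrum H R = {c. \<not> (\<exists>T\<in>bounded_ops H H.
     compose (carrier H) T (op_diff H H R (op_scalar H c)) = restrict id (carrier H) \<and>
     compose (carrier H) (op_diff H H R (op_scalar H c)) T = restrict id (carrier H))}"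

definition unitary_ops :: "'a inner_space \<Rightarrow> 'a inner_space \<Rightarrow> ('a \<Rightarrow> 'a) set" where
  "unitary_ops H K = {U \<in> bounded_ops H K.
     bij_betw U (carrier H) (carrier K) \<and>
     (\<forall>x\<in>carrier H. \<forall>y\<in>carrier H. ip K (U x) (U y) = ip H x y)}"

text \<open>The operator \<open>U R U\<^sup>*\<close> on \<open>K\<close>, for \<open>R\<close> on \<open>H\<close> and \<open>U\<close> from \<open>H\<close> to \<open>K\<close>.\<close>

definition conjugate ::
    "'a inner_space \<Rightarrow> 'a inner_space \<Rightarrow> ('a \<Rightarrow> 'a) \<Rightarrow> ('a \<Rightarrow> 'a) \<Rightarrow> 'a \<Rightarrow> 'a" where
  "conjugate H K U R = compose (carrier K) U (compose (carrier K) R (adj H K U))"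

section \<open>The set of operators and the distance\<close>

definition B01 :: "'a inner_space \<Rightarrow> ('a \<Rightarrow> 'a) set" where
  "B01 H = {R \<in> bounded_ops H H. self_adjoint H R \<and> inj_on R (carrier H) \<and>
     spectrum H R \<subseteq> complex_of_real ` {0..1}}"

text \<open>An element of the union over all spaces is an operator paired with the space it acts
  in, since the bare function does not determine the Hilbert space structure.\<close>

definition B01_all :: "'a inner_space set \<Rightarrow> ('a inner_space \<times> ('a \<Rightarrow> 'a)) set" where
  "B01_all HS = (SIGMA H:HS. B01 H)"

fun d_uni :: "'a inner_space \<times> ('a \<Rightarrow> 'a) \<Rightarrow> 'a inner_space \<times> ('a \<Rightarrow> 'a) \<Rightarrow> real" where
  "d_uni (H, R) (K, S) = (INF U\<in>unitary_ops H K. opnorm K K (op_diff K K S (conjugate H K U R)))"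

fun unitarily_equivalent ::
    "'a inner_space \<times> ('a \<Rightarrow> 'a) \<Rightarrow> 'a inner_space \<times> ('a \<Rightarrow> 'a) \<Rightarrow> bool" where
  "unitarily_equivalent (H, R) (K, S) \<longleftrightarrow> (\<exists>U\<in>unitary_ops H K. S = conjugate H K U R)"

definition pseudometric_on :: "'b set \<Rightarrow> ('b \<Rightarrow> 'b \<Rightarrow> real) \<Rightarrow> bool" where
  "pseudometric_on M d \<longleftrightarrow>
     (\<forall>x\<in>M. \<forall>y\<in>M. 0 \<le> d x y) \<and>
     (\<forall>x\<in>M. d x x = 0) \<and>
     (\<forall>x\<in>M. \<forall>y\<in>M. d x y = d y x) \<and>
     (\<forall>x\<in>M. \<forall>y\<in>M. \<forall>z\<in>M. d x z \<le> d x y + d y z)"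

end

theory Submission
  imports Defs
begin

text \<open>
  The statement about sequences is the definition of an infimum, and symmetry and the triangle
  inequality come from inverting and composing unitary operators. Two points need an argument.

  First, the infimum must range over a nonempty set; for the empty set its value would be
  arbitrary. That is where separability, completeness and infinite dimension enter. A maximal
  orthonormal set (Zorn) is countable by separability and infinite because a finite one
  would span, so both spaces have orthonormal bases indexed by the natural numbers. By
  Bessel's inequality and the Riesz-Fischer theorem the coordinate sequences are in either
  space precisely the square-summable ones, and by Parseval's identity matching vectors with
  equal coordinates preserves the inner product (\<open>unitary_ops_nonempty\<close>).

  Second, the norm of \<open>S - U R U\<^sup>*\<close> on \<open>K\<close> equals that of the intertwining defect \<open>S U - U R\<close>
  from \<open>H\<close> to \<open>K\<close> (\<open>defect_eq_SUP\<close>). For the defect, \<open>R U\<^sup>* - U\<^sup>* S = - U\<^sup>* (S U - U R)\<close> gives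
  symmetry, and \<open>T V U - V U R = (T V - V S) U + V (S U - U R)\<close> gives the triangle
  inequality.
\<close>

section \<open>Geometry of an inner product space\<close>

context inner_product_space
begin

lemma smult_in_carrier [simp]: "x \<in> carrier H \<Longrightarrow> c \<odot> x \<in> carrier H"
  using smult_closed[of c x] by (simp add: ring_of_type_algebra_def)

lemma ip_add_right:
  assumes "x \<in> carrier H" "y \<in> carrier H" "z \<in> carrier H"
  shows "ip H z (x \<oplus> y) = ip H z x + ip H z y"
  using assms ip_add_left[of x y z] by (simp add: ip_commute[of z])

lemma ip_smult_right:
  assumes "x \<in> carrier H" "y \<in> carrier H"
  shows "ip H y (c \<odot> x) = cnj c * ip H y x"
  using assms ip_smult_left[of x y c] by (simp add: ip_commute[of y])

lemma ip_zero_left: "x \<in> carrier H \<Longrightarrow> ip H \<zero> x = 0"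
  using ip_add_left[of \<zero> \<zero> x] by simp

lemma ip_zero_right: "x \<in> carrier H \<Longrightarrow> ip H x \<zero> = 0"
  using ip_add_right[of \<zero> \<zero> x] by simp

lemma ip_diff_left:
  assumes "x \<in> carrier H" "y \<in> carrier H" "z \<in> carrier H"
  shows "ip H (x \<ominus> y) z = ip H x z - ip H y z"
proof -
  have "ip H (\<ominus> y) z + ip H y z = 0"
    using assms ip_add_left[of "\<ominus> y" y z] by (simp add: M.l_neg ip_zero_left)
  then show ?thesis
    using assms by (simp add: a_minus_def ip_add_left add_eq_0_iff2)
qed

lemma ip_diff_right:
  assumes "x \<in> carrier H" "y \<in> carrier H" "z \<in> carrier H"
  shows "ip H z (x \<ominus> y) = ip H z x - ip H z y"
  using assms ip_diff_left[of x y z] by (simp add: ip_commute[of z])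

lemma ip_finsum_left:
  assumes "finite A" "f \<in> A \<rightarrow> carrier H" "z \<in> carrier H"
  shows "ip H (\<Oplus>i\<in>A. f i) z = (\<Sum>i\<in>A. ip H (f i) z)"
  using assms
proof (induction rule: finite_induct)
  case empty
  then show ?case by (simp add: ip_zero_left)
next
  case (insert a F)
  then have "f \<in> F \<rightarrow> carrier H" "f a \<in> carrier H" by auto
  with insert show ?case by (simp add: ip_add_left)
qed

lemmas ip_simps = ip_add_left ip_add_right ip_smult_left ip_smult_right
  ip_zero_left ip_zero_right ip_diff_left ip_diff_right

lemma ip_self_real: "x \<in> carrier H \<Longrightarrow> ip H x x = complex_of_real (Re (ip H x x))"
  using ip_commute[of x x] by (simp add: complex_eq_iff)

lemma ip_self_nonneg: "x \<in> carrier H \<Longrightarrow> 0 \<le> Re (ip H x x)"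
  using ip_pos[of x] by (cases "x = \<zero>") (auto simp: ip_zero_left)

lemma hnorm_nonneg: "x \<in> carrier H \<Longrightarrow> 0 \<le> hnorm H x"
  by (simp add: hnorm_def ip_self_nonneg)

lemma hnorm_sq: "x \<in> carrier H \<Longrightarrow> (hnorm H x)\<^sup>2 = Re (ip H x x)"
  by (simp add: hnorm_def ip_self_nonneg)

lemma ip_self_hnorm: "x \<in> carrier H \<Longrightarrow> ip H x x = complex_of_real ((hnorm H x)\<^sup>2)"
  by (metis hnorm_sq ip_self_real)

lemma hnorm_eq_0_iff: "x \<in> carrier H \<Longrightarrow> hnorm H x = 0 \<longleftrightarrow> x = \<zero>"
  using ip_pos[of x] by (cases "x = \<zero>") (auto simp: hnorm_def ip_zero_left)

lemma diff_eq_zero_iff: "\<lbrakk>x \<in> carrier H; y \<in> carrier H\<rbrakk> \<Longrightarrow> x \<ominus> y = \<zero> \<longleftrightarrow> x = y"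
  by (metis M.minus_equality M.minus_minus M.r_neg a_minus_def M.a_inv_closed M.a_comm)

text \<open>Testing against all vectors turns every vector identity below into an identity between
  complex numbers, where arithmetic is automatic.\<close>

lemma eq_if_ip_eq:
  assumes "x \<in> carrier H" "y \<in> carrier H"
    and "\<And>z. z \<in> carrier H \<Longrightarrow> ip H x z = ip H y z"
  shows "x = y"
proof -
  have "ip H (x \<ominus> y) (x \<ominus> y) = 0"
    using assms by (simp add: ip_simps)
  then have "x \<ominus> y = \<zero>"
    using ip_pos[of "x \<ominus> y"] assms by fastforce
  then show ?thesis
    using assms by (simp add: diff_eq_zero_iff)
qed

lemma diff_self [simp]: "x \<in> carrier H \<Longrightarrow> x \<ominus> x = \<zero>"
  by (simp add: a_minus_def M.r_neg)

lemma diff_zero [simp]: "x \<in> carrier H \<Longrightarrow> x \<ominus> \<zero> = x"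
  by (rule eq_if_ip_eq) (simp_all add: ip_simps)

lemma diff_add_diff:
  "\<lbrakk>x \<in> carrier H; y \<in> carrier H; z \<in> carrier H\<rbrakk> \<Longrightarrow> (x \<ominus> y) \<oplus> (y \<ominus> z) = x \<ominus> z"
  by (rule eq_if_ip_eq) (simp_all add: ip_simps)

lemma hnorm_zero [simp]: "hnorm H \<zero> = 0"
  by (simp add: hnorm_eq_0_iff)

lemma hnorm_diff_commute:
  assumes "x \<in> carrier H" "y \<in> carrier H"
  shows "hnorm H (x \<ominus> y) = hnorm H (y \<ominus> x)"
  using assms by (simp add: hnorm_def ip_simps algebra_simps)

lemma Cauchy_Schwarz:
  assumes x: "x \<in> carrier H" and y: "y \<in> carrier H"
  shows "cmod (ip H x y) \<le> hnorm H x * hnorm H y"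
proof (cases "y = \<zero>")
  case True
  with x show ?thesis by (simp add: ip_zero_right)
next
  case False
  define n where "n = Re (ip H y y)"
  have n: "0 < n" "ip H y y = complex_of_real n"
    using y False ip_pos ip_self_real by (auto simp: n_def)
  define p where "p = ip H x y"
  have yx: "ip H y x = cnj p"
    using x y by (simp add: p_def ip_commute[of y])
  define z where "z = x \<ominus> (p / n) \<odot> y"
  \<comment> \<open>\<open>z\<close> is the component of \<open>x\<close> orthogonal to \<open>y\<close>.\<close>
  have z: "z \<in> carrier H" using x y by (simp add: z_def)
  have "ip H z z = ip H x x - p * cnj p / n"
    using x y n by (simp add: z_def ip_simps yx flip: p_def)
  also have "p * cnj p / n = complex_of_real ((cmod p)\<^sup>2 / n)"
    by (simp only: of_real_divide complex_norm_square)
  finally have "0 \<le> Re (ip H x x) - (cmod p)\<^sup>2 / n"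
    using ip_self_nonneg[OF z] by (metis Re_complex_of_real minus_complex.sel(1))
  then have "(cmod p)\<^sup>2 \<le> Re (ip H x x) * n"
    using n by (simp add: field_simps)
  also have "\<dots> = (hnorm H x * hnorm H y)\<^sup>2"
    using x y by (simp add: power_mult_distrib hnorm_sq n_def)
  finally show ?thesis
    unfolding p_def by (rule power2_le_imp_le) (simp add: x y hnorm_nonneg)
qed

lemma hnorm_triangle:
  assumes x: "x \<in> carrier H" and y: "y \<in> carrier H"
  shows "hnorm H (x \<oplus> y) \<le> hnorm H x + hnorm H y"
proof (rule power2_le_imp_le)
  have "Re (ip H x y) \<le> hnorm H x * hnorm H y"
    using Cauchy_Schwarz[OF x y] complex_Re_le_cmod order_trans by blast
  moreover have "Re (ip H y x) = Re (ip H x y)"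
    using x y by (simp add: ip_commute[of y])
  ultimately show "(hnorm H (x \<oplus> y))\<^sup>2 \<le> (hnorm H x + hnorm H y)\<^sup>2"
    using x y by (simp add: hnorm_sq ip_simps power2_sum)
qed (simp add: x y hnorm_nonneg)

lemma hnorm_triangle_diff:
  assumes "x \<in> carrier H" "y \<in> carrier H" "z \<in> carrier H"
  shows "hnorm H (x \<ominus> z) \<le> hnorm H (x \<ominus> y) + hnorm H (y \<ominus> z)"
  using assms hnorm_triangle[of "x \<ominus> y" "y \<ominus> z"] by (simp add: diff_add_diff)

sublocale metric: Metric_space "carrier H" "hdist H"
proof
  show "hdist H x y = 0 \<longleftrightarrow> x = y" if "x \<in> carrier H" "y \<in> carrier H" for x y
    using that by (simp add: hdist_def hnorm_eq_0_iff diff_eq_zero_iff)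
qed (auto simp: hdist_def hnorm_nonneg hnorm_diff_commute hnorm_triangle_diff)

lemma ip_tendsto:
  assumes lim: "limitin metric.mtopology s x sequentially"
    and s: "\<And>n. s n \<in> carrier H" and y: "y \<in> carrier H"
  shows "(\<lambda>n. ip H (s n) y) \<longlonglongrightarrow> ip H x y"
proof -
  have x: "x \<in> carrier H" and d: "(\<lambda>n. hdist H (s n) x) \<longlonglongrightarrow> 0"
    using lim by (auto simp: metric.limitin_metric_dist_null)
  have "(\<lambda>n. ip H (s n) y - ip H x y) \<longlonglongrightarrow> 0"
  proof (rule Lim_null_comparison)
    show "(\<lambda>n. hdist H (s n) x * hnorm H y) \<longlonglongrightarrow> 0"
      using tendsto_mult_left_zero[OF d] .
    show "\<forall>\<^sub>F n in sequentially. cmod (ip H (s n) y - ip H x y) \<le> hdist H (s n) x * hnorm H y"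
    proof (rule always_eventually, rule allI)
      fix n
      show "cmod (ip H (s n) y - ip H x y) \<le> hdist H (s n) x * hnorm H y"
        using Cauchy_Schwarz[of "s n \<ominus> x" y] s x y
        by (simp add: ip_diff_left hdist_def)
    qed
  qed
  then show ?thesis by (simp add: LIM_zero_iff)
qed

section \<open>Orthonormal bases\<close>

definition orthonormal_set :: "'a set \<Rightarrow> bool" where
  "orthonormal_set B \<longleftrightarrow> B \<subseteq> carrier H \<and>
     (\<forall>b\<in>B. \<forall>c\<in>B. ip H b c = (if b = c then 1 else 0))"

text \<open>In a complete space an orthonormal family is a basis as soon as only the zero vector is
  orthogonal to it; this form needs no infinite sums.\<close>

definition orthonormal_basis :: "(nat \<Rightarrow> 'a) \<Rightarrow> bool" where
  "orthonormal_basis e \<longleftrightarrow> (\<forall>i. e i \<in> carrier H) \<and>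
     (\<forall>i j. ip H (e i) (e j) = (if i = j then 1 else 0)) \<and>
     (\<forall>x\<in>carrier H. (\<forall>i. ip H x (e i) = 0) \<longrightarrow> x = \<zero>)"

text \<open>A nonzero vector orthogonal to a maximal orthonormal set could be normalized and added.\<close>

lemma ex_total_orthonormal_set:
  "\<exists>B. orthonormal_set B \<and> (\<forall>x\<in>carrier H. (\<forall>b\<in>B. ip H x b = 0) \<longrightarrow> x = \<zero>)"
proof -
  have "\<exists>B\<in>{B. orthonormal_set B}. \<forall>D\<in>{B. orthonormal_set B}. B \<subseteq> D \<longrightarrow> D = B"
  proof (rule subset_Zorn')
    fix C assume C: "subset.chain ({B. orthonormal_set B}) C"
    show "\<Union>C \<in> {B. orthonormal_set B}"
      unfolding mem_Collect_eq orthonormal_set_def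
    proof (intro conjI ballI)
      show "\<Union>C \<subseteq> carrier H"
        using C by (auto simp: subset.chain_def orthonormal_set_def)
      fix b c assume "b \<in> \<Union>C" "c \<in> \<Union>C"
      then obtain D where "D \<in> C" "b \<in> D" "c \<in> D"
        using C unfolding subset_chain_def Union_iff by (metis subsetD)
      then show "ip H b c = (if b = c then 1 else 0)"
        using C by (auto simp: subset.chain_def orthonormal_set_def)
    qed
  qed
  then obtain B where B: "orthonormal_set B"
    and max: "\<And>D. orthonormal_set D \<Longrightarrow> B \<subseteq> D \<Longrightarrow> D = B" by auto
  have "x = \<zero>" if x: "x \<in> carrier H" and orth: "\<And>b. b \<in> B \<Longrightarrow> ip H x b = 0" for x
  proof (rule ccontr)
    assume "x \<noteq> \<zero>"
    then have pos: "0 < hnorm H x"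
      using x hnorm_nonneg[OF x] hnorm_eq_0_iff[OF x] by simp
    define u where "u = complex_of_real (1 / hnorm H x) \<odot> x"
    have u: "u \<in> carrier H" using x by (simp add: u_def)
    have uu: "ip H u u = 1"
      using x pos by (simp add: u_def ip_simps ip_self_hnorm[OF x] power2_eq_square)
    have ub: "ip H u b = 0" "ip H b u = 0" if "b \<in> B" for b
      using that orth[OF that] x B ip_commute[of b x]
      by (auto simp: u_def ip_simps orthonormal_set_def subset_iff)
    have "orthonormal_set (insert u B)"
      using B u uu ub by (auto simp: orthonormal_set_def)
    then have "u \<in> B" using max by blast
    with ub uu show False by fastforce
  qed
  with B show ?thesis by blast
qed

text \<open>Distinct members of an orthonormal set are at distance \<open>sqrt 2\<close>, so a choice of a point
  of a countable dense set closer than \<open>1/2\<close> to each of them is injective.\<close>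

lemma countable_orthonormal_set:
  assumes "separable H" and B: "orthonormal_set B"
  shows "countable B"
proof -
  obtain C where C: "countable C" "C \<subseteq> carrier H"
    and dense: "metric.mtopology closure_of C = carrier H"
    using assms(1) by (auto simp: separable_def separable_space_def)
  have BH: "b \<in> carrier H" if "b \<in> B" for b
    using B that by (auto simp: orthonormal_set_def)
  have "\<exists>c\<in>C. hdist H b c < 1/2" if "b \<in> B" for b
  proof -
    have "b \<in> metric.mtopology closure_of C" using BH[OF that] dense by simp
    then have "\<forall>r>0. \<exists>y\<in>C. y \<in> metric.mball b r"
      by (simp add: metric.metric_closure_of)
    then show ?thesis by (metis half_gt_zero metric.in_mball zero_less_one)
  qed
  then obtain g where g: "\<And>b. b \<in> B \<Longrightarrow> g b \<in> C \<and> hdist H b (g b) < 1/2" by metis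
  have "inj_on g B"
  proof (rule inj_onI, rule ccontr)
    fix b c assume bc: "b \<in> B" "c \<in> B" "g b = g c" "b \<noteq> c"
    have "hdist H b c \<le> hdist H b (g b) + hdist H (g b) c"
      using bc g C BH by (intro metric.triangle) auto
    also have "\<dots> < 1/2 + 1/2"
      using g bc by (metis add_strict_mono metric.commute)
    finally have "hdist H b c < 1" by simp
    moreover have "(hdist H b c)\<^sup>2 = 2"
      using bc B BH by (simp add: hdist_def hnorm_sq ip_simps orthonormal_set_def)
    ultimately show False
      using power_mono[of "hdist H b c" 1 2] by simp
  qed
  moreover have "countable (g ` B)"
    using g C by (meson countable_subset image_subsetI)
  ultimately show ?thesis by (metis countable_image_inj_on)
qed

text \<open>The defect of a vector from its Fourier sum over a finite orthonormal set is orthogonal to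
  the set, so a finite total orthonormal set spans.\<close>

lemma finite_dimensional_if_finite_total:
  assumes B: "orthonormal_set B" and fin: "finite B"
    and tot: "\<And>x. x \<in> carrier H \<Longrightarrow> (\<And>b. b \<in> B \<Longrightarrow> ip H x b = 0) \<Longrightarrow> x = \<zero>"
  shows "finite_dimensional H"
proof -
  have BH: "B \<subseteq> carrier H" using B by (simp add: orthonormal_set_def)
  have "x = (\<Oplus>b\<in>B. ip H x b \<odot> b)" if x: "x \<in> carrier H" for x
  proof -
    have mem: "(\<lambda>b. ip H x b \<odot> b) \<in> B \<rightarrow> carrier H" using BH by auto
    then have sum: "(\<Oplus>b\<in>B. ip H x b \<odot> b) \<in> carrier H" by (rule M.finsum_closed)
    have "x \<ominus> (\<Oplus>b\<in>B. ip H x b \<odot> b) = \<zero>"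
    proof (rule tot)
      fix c assume c: "c \<in> B"
      have "ip H (\<Oplus>b\<in>B. ip H x b \<odot> b) c = (\<Sum>b\<in>B. ip H (ip H x b \<odot> b) c)"
        using mem fin c BH by (intro ip_finsum_left) auto
      also have "\<dots> = (\<Sum>b\<in>B. if b = c then ip H x b else 0)"
        using c B BH by (intro sum.cong) (auto simp: ip_smult_left orthonormal_set_def subset_iff)
      also have "\<dots> = ip H x c" using fin c by simp
      finally show "ip H (x \<ominus> (\<Oplus>b\<in>B. ip H x b \<odot> b)) c = 0"
        using x c BH sum by (simp add: ip_diff_left subset_iff)
    qed (use x sum in simp)
    then show ?thesis using x sum by (simp only: diff_eq_zero_iff)
  qed
  then show ?thesis
    unfolding finite_dimensional_def using fin BH by blast
qed

lemma ex_orthonormal_basis: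
  assumes "separable H" "\<not> finite_dimensional H"
  shows "\<exists>e. orthonormal_basis e"
proof -
  obtain B where B: "orthonormal_set B"
    and tot: "\<And>x. x \<in> carrier H \<Longrightarrow> (\<And>b. b \<in> B \<Longrightarrow> ip H x b = 0) \<Longrightarrow> x = \<zero>"
    using ex_total_orthonormal_set by blast
  have "countable B" "infinite B"
    using countable_orthonormal_set finite_dimensional_if_finite_total assms B tot by blast+
  then obtain e where e: "bij_betw e (UNIV :: nat set) B"
    using bij_betw_from_nat_into by blast
  then have eB: "e i \<in> B" for i by (auto simp: bij_betw_def)
  have inj: "e i = e j \<longleftrightarrow> i = j" for i j
    using e by (auto simp: bij_betw_def inj_on_def)
  have surj: "\<exists>i. b = e i" if "b \<in> B" for b
    using e that by (auto simp: bij_betw_def)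
  have "orthonormal_basis e"
    unfolding orthonormal_basis_def
    using B eB inj surj tot by (metis orthonormal_set_def subset_iff)
  then show ?thesis by blast
qed

lemma
  assumes e: "orthonormal_basis e"
  shows orthonormal_basis_carrier: "e i \<in> carrier H"
    and orthonormal_basis_ip: "ip H (e i) (e j) = (if i = j then 1 else 0)"
  using e by (simp_all add: orthonormal_basis_def)

lemma eq_if_coordinates_eq:
  assumes e: "orthonormal_basis e" and x: "x \<in> carrier H" and y: "y \<in> carrier H"
    and eq: "\<And>i. ip H x (e i) = ip H y (e i)"
  shows "x = y"
proof -
  have "x \<ominus> y = \<zero>"
    using e x y eq by (simp add: orthonormal_basis_def ip_diff_left)
  then show ?thesis using x y by (simp add: diff_eq_zero_iff)
qed

definition fourier_sum :: "(nat \<Rightarrow> 'a) \<Rightarrow> (nat \<Rightarrow> complex) \<Rightarrow> nat \<Rightarrow> 'a" where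
  "fourier_sum e c n = (\<Oplus>i\<in>{..<n}. c i \<odot> e i)"

lemma fourier_sum_carrier:
  assumes "orthonormal_basis e"
  shows "fourier_sum e c n \<in> carrier H"
  unfolding fourier_sum_def
  using assms by (intro M.finsum_closed) (auto simp: orthonormal_basis_carrier)

lemma ip_fourier_sum_left:
  assumes e: "orthonormal_basis e" and z: "z \<in> carrier H"
  shows "ip H (fourier_sum e c n) z = (\<Sum>i<n. c i * cnj (ip H z (e i)))"
proof -
  have "ip H (fourier_sum e c n) z = (\<Sum>i<n. ip H (c i \<odot> e i) z)"
    unfolding fourier_sum_def using e z
    by (intro ip_finsum_left) (auto simp: orthonormal_basis_carrier)
  also have "\<dots> = (\<Sum>i<n. c i * cnj (ip H z (e i)))"
  proof (rule sum.cong)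
    fix i
    have "e i \<in> carrier H" using e by (rule orthonormal_basis_carrier)
    then show "ip H (c i \<odot> e i) z = c i * cnj (ip H z (e i))"
      using z ip_commute[of "e i" z] by (simp add: ip_smult_left)
  qed simp
  finally show ?thesis .
qed

lemma fourier_sum_coordinate:
  assumes e: "orthonormal_basis e"
  shows "ip H (fourier_sum e c n) (e j) = (if j < n then c j else 0)"
proof -
  have "ip H (fourier_sum e c n) (e j) = (\<Sum>i<n. if i = j then c i else 0)"
    using e by (simp add: ip_fourier_sum_left orthonormal_basis_carrier orthonormal_basis_ip
        if_distrib cong: if_cong)
  then show ?thesis by simp
qed

text \<open>Pythagoras. Only the first \<open>n\<close> coordinates of \<open>x\<close> have to agree with \<open>c\<close>, so that \<open>x\<close> may be a
  longer Fourier sum (for the Cauchy property) as well as an arbitrary vector (for Bessel's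
  inequality).\<close>

lemma hnorm_diff_fourier_sum:
  assumes e: "orthonormal_basis e" and x: "x \<in> carrier H"
    and c: "\<And>i. i < n \<Longrightarrow> ip H x (e i) = c i"
  shows "(hnorm H (x \<ominus> fourier_sum e c n))\<^sup>2 = (hnorm H x)\<^sup>2 - (\<Sum>i<n. (cmod (c i))\<^sup>2)"
proof -
  let ?s = "fourier_sum e c n" and ?S = "complex_of_real (\<Sum>i<n. (cmod (c i))\<^sup>2)"
  have s: "?s \<in> carrier H" using e by (rule fourier_sum_carrier)
  have "ip H ?s z = ?S" if "z \<in> carrier H" "\<And>i. i < n \<Longrightarrow> ip H z (e i) = c i" for z
    using e that by (simp add: ip_fourier_sum_left flip: complex_norm_square)
  then have "ip H ?s x = ?S" "ip H ?s ?s = ?S"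
    using e x c s by (simp_all add: fourier_sum_coordinate)
  moreover from this have "ip H x ?s = ?S"
    using ip_commute[OF x s] by simp
  ultimately show ?thesis
    using x s by (simp add: hnorm_sq ip_diff_left ip_diff_right)
qed

lemma Bessel_summable:
  assumes e: "orthonormal_basis e" and x: "x \<in> carrier H"
  shows "summable (\<lambda>i. (cmod (ip H x (e i)))\<^sup>2)"
proof (rule summableI_nonneg_bounded)
  fix n
  have "0 \<le> (hnorm H (x \<ominus> fourier_sum e (\<lambda>i. ip H x (e i)) n))\<^sup>2" by simp
  then show "(\<Sum>i<n. (cmod (ip H x (e i)))\<^sup>2) \<le> (hnorm H x)\<^sup>2"
    using hnorm_diff_fourier_sum[OF e x, of n "\<lambda>i. ip H x (e i)"] by simp
qed simp

lemma hdist_fourier_sum: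
  assumes e: "orthonormal_basis e"
  shows "(hdist H (fourier_sum e c m) (fourier_sum e c n))\<^sup>2
       = \<bar>(\<Sum>i<m. (cmod (c i))\<^sup>2) - (\<Sum>i<n. (cmod (c i))\<^sup>2)\<bar>"
proof (induction n m rule: linorder_wlog)
  case (le n m)
  have carr: "fourier_sum e c k \<in> carrier H" for k using e by (rule fourier_sum_carrier)
  have norm: "(hnorm H (fourier_sum e c k))\<^sup>2 = (\<Sum>i<k. (cmod (c i))\<^sup>2)" for k
    using carr e
    by (simp add: hnorm_sq ip_fourier_sum_left fourier_sum_coordinate flip: complex_norm_square)
  have "(\<Sum>i<n. (cmod (c i))\<^sup>2) \<le> (\<Sum>i<m. (cmod (c i))\<^sup>2)"
    using le by (intro sum_mono2) auto
  moreover have "(hnorm H (fourier_sum e c m \<ominus> fourier_sum e c n))\<^sup>2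
      = (\<Sum>i<m. (cmod (c i))\<^sup>2) - (\<Sum>i<n. (cmod (c i))\<^sup>2)"
    using le hnorm_diff_fourier_sum[OF e carr, of n m c] e
    by (simp add: fourier_sum_coordinate norm)
  ultimately show ?case using carr by (simp add: hdist_def)
next
  case (sym n m)
  then show ?case by (simp add: metric.commute abs_minus_commute)
qed

end

context hilbert_space
begin

text \<open>The Riesz-Fischer theorem: the Fourier sums of a square-summable sequence are Cauchy
  because the squared distance of two of them is a difference of partial sums of a convergent
  series.\<close>

lemma Riesz_Fischer:
  assumes e: "orthonormal_basis e" and c: "summable (\<lambda>i. (cmod (c i))\<^sup>2)"
  obtains x where "x \<in> carrier H" "\<And>i. ip H x (e i) = c i"
    "limitin metric.mtopology (fourier_sum e c) x sequentially"
proof -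
  have carr: "fourier_sum e c k \<in> carrier H" for k using e by (rule fourier_sum_carrier)
  have "metric.MCauchy (fourier_sum e c)"
    unfolding metric.MCauchy_def
  proof (intro conjI allI impI)
    fix \<epsilon> :: real assume "0 < \<epsilon>"
    then have "0 < \<epsilon>\<^sup>2" by simp
    then obtain N where N: "\<And>m n. N \<le> m \<Longrightarrow> N \<le> n \<Longrightarrow>
        dist (\<Sum>i<m. (cmod (c i))\<^sup>2) (\<Sum>i<n. (cmod (c i))\<^sup>2) < \<epsilon>\<^sup>2"
      using c unfolding summable_iff_convergent Cauchy_convergent_iff[symmetric] Cauchy_def
      by metis
    have "hdist H (fourier_sum e c m) (fourier_sum e c n) < \<epsilon>" if "N \<le> m" "N \<le> n" for m n
    proof (rule power2_less_imp_less)
      show "(hdist H (fourier_sum e c m) (fourier_sum e c n))\<^sup>2 < \<epsilon>\<^sup>2"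
        using N[OF that] by (simp add: hdist_fourier_sum[OF e] dist_real_def)
    qed (use \<open>0 < \<epsilon>\<close> in simp)
    then show "\<exists>N. \<forall>m n. N \<le> m \<longrightarrow> N \<le> n \<longrightarrow>
        hdist H (fourier_sum e c m) (fourier_sum e c n) < \<epsilon>" by blast
  qed (use carr in auto)
  then obtain x where lim: "limitin metric.mtopology (fourier_sum e c) x sequentially"
    using complete by (auto simp: metric.mcomplete_def)
  then have x: "x \<in> carrier H" by (simp add: metric.limitin_metric)
  have "ip H x (e i) = c i" for i
  proof (rule LIMSEQ_unique)
    show "(\<lambda>n. ip H (fourier_sum e c n) (e i)) \<longlonglongrightarrow> ip H x (e i)"
      using lim carr orthonormal_basis_carrier[OF e] by (rule ip_tendsto)
    have "\<forall>\<^sub>F n in sequentially. ip H (fourier_sum e c n) (e i) = c i"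
      using eventually_gt_at_top[of i]
      by eventually_elim (simp add: fourier_sum_coordinate[OF e])
    then show "(\<lambda>n. ip H (fourier_sum e c n) (e i)) \<longlonglongrightarrow> c i"
      by (rule tendsto_eventually)
  qed
  with that x lim show ?thesis by blast
qed

text \<open>The Riesz-Fischer limit of the Fourier sums of \<open>x\<close> has the coordinates of \<open>x\<close>, hence is \<open>x\<close>;
  the inner product is continuous along these sums.\<close>

lemma Parseval:
  assumes e: "orthonormal_basis e" and x: "x \<in> carrier H" and y: "y \<in> carrier H"
  shows "(\<lambda>i. ip H x (e i) * cnj (ip H y (e i))) sums ip H x y"
proof -
  let ?c = "\<lambda>i. ip H x (e i)"
  obtain x' where x': "x' \<in> carrier H" "\<And>i. ip H x' (e i) = ?c i"
    and lim: "limitin metric.mtopology (fourier_sum e ?c) x' sequentially"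
    using Riesz_Fischer[OF e Bessel_summable[OF e x]] by blast
  have "x' = x" using eq_if_coordinates_eq[OF e x'(1) x x'(2)] .
  with lim have "(\<lambda>n. ip H (fourier_sum e ?c n) y) \<longlonglongrightarrow> ip H x y"
    using fourier_sum_carrier[OF e] y by (intro ip_tendsto) auto
  then show ?thesis
    by (simp add: sums_def ip_fourier_sum_left[OF e y])
qed

end

section \<open>Unitary operators\<close>

lemma
  assumes "A \<in> bounded_ops H K"
  shows bounded_ops_carrier: "x \<in> carrier H \<Longrightarrow> A x \<in> carrier K"
    and bounded_ops_diff: "\<lbrakk>inner_product_space H; inner_product_space K;
      x \<in> carrier H; y \<in> carrier H\<rbrakk> \<Longrightarrow> A (x \<ominus>\<^bsub>H\<^esub> y) = A x \<ominus>\<^bsub>K\<^esub> A y"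
proof -
  show carr: "A x \<in> carrier K" if "x \<in> carrier H" for x
    using assms that by (auto simp: bounded_ops_def)
  assume HK: "inner_product_space H" "inner_product_space K"
    and x: "x \<in> carrier H" and y: "y \<in> carrier H"
  interpret H: inner_product_space H by fact
  interpret K: inner_product_space K by fact
  have xy: "x \<ominus>\<^bsub>H\<^esub> y \<in> carrier H" using x y by simp
  have "(x \<ominus>\<^bsub>H\<^esub> y) \<oplus>\<^bsub>H\<^esub> y = x"
    using x y by (intro H.eq_if_ip_eq) (simp_all add: H.ip_simps)
  moreover have "A (v \<oplus>\<^bsub>H\<^esub> w) = A v \<oplus>\<^bsub>K\<^esub> A w" if "v \<in> carrier H" "w \<in> carrier H" for v w
    using assms that unfolding bounded_ops_def by blast
  ultimately have eq: "A x = A (x \<ominus>\<^bsub>H\<^esub> y) \<oplus>\<^bsub>K\<^esub> A y"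
    using xy y by metis
  show "A (x \<ominus>\<^bsub>H\<^esub> y) = A x \<ominus>\<^bsub>K\<^esub> A y"
    unfolding eq using carr[OF y] carr[OF xy]
    by (intro K.eq_if_ip_eq) (simp_all add: K.ip_simps)
qed

lemma bounded_ops_bound:
  assumes A: "A \<in> bounded_ops H K" and H: "inner_product_space H"
  obtains C where "\<And>x. \<lbrakk>x \<in> carrier H; hnorm H x \<le> 1\<rbrakk> \<Longrightarrow> hnorm K (A x) \<le> C"
proof -
  interpret inner_product_space H by fact
  obtain C where C: "\<And>x. x \<in> carrier H \<Longrightarrow> hnorm K (A x) \<le> C * hnorm H x"
    using A unfolding bounded_ops_def by blast
  have "hnorm K (A x) \<le> \<bar>C\<bar>" if x: "x \<in> carrier H" "hnorm H x \<le> 1" for x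
  proof -
    have "C * hnorm H x \<le> \<bar>C\<bar> * 1"
      using x hnorm_nonneg by (intro mult_mono) auto
    with C[OF x(1)] show ?thesis by simp
  qed
  with that show ?thesis by blast
qed

lemma
  assumes "U \<in> unitary_ops H K"
  shows unitary_ops_bounded: "U \<in> bounded_ops H K"
    and unitary_ops_bij: "bij_betw U (carrier H) (carrier K)"
    and unitary_ops_carrier: "x \<in> carrier H \<Longrightarrow> U x \<in> carrier K"
    and unitary_ops_ip: "\<lbrakk>x \<in> carrier H; y \<in> carrier H\<rbrakk> \<Longrightarrow> ip K (U x) (U y) = ip H x y"
    and unitary_ops_hnorm: "x \<in> carrier H \<Longrightarrow> hnorm K (U x) = hnorm H x"
    and unitary_ops_ex: "y \<in> carrier K \<Longrightarrow> \<exists>x\<in>carrier H. y = U x"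
proof -
  show "U \<in> bounded_ops H K" and "bij_betw U (carrier H) (carrier K)"
    using assms by (simp_all add: unitary_ops_def)
  then show "x \<in> carrier H \<Longrightarrow> U x \<in> carrier K" "y \<in> carrier K \<Longrightarrow> \<exists>x\<in>carrier H. y = U x"
    by (auto simp: bij_betw_def)
  show "\<lbrakk>x \<in> carrier H; y \<in> carrier H\<rbrakk> \<Longrightarrow> ip K (U x) (U y) = ip H x y"
    "x \<in> carrier H \<Longrightarrow> hnorm K (U x) = hnorm H x"
    using assms by (simp_all add: unitary_ops_def hnorm_def)
qed

text \<open>Surjections that preserve the inner product are unitary: linearity follows from testing
  against the vectors \<open>U z\<close>.\<close>

lemma unitary_opsI:
  assumes H: "inner_product_space H" and K: "inner_product_space K"
    and U: "U \<in> carrier H \<rightarrow>\<^sub>E carrier K" and surj: "U ` carrier H = carrier K"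
    and ip: "\<And>x y. \<lbrakk>x \<in> carrier H; y \<in> carrier H\<rbrakk> \<Longrightarrow> ip K (U x) (U y) = ip H x y"
  shows "U \<in> unitary_ops H K"
proof -
  interpret H: inner_product_space H by fact
  interpret K: inner_product_space K by fact
  have carr: "U x \<in> carrier K" if "x \<in> carrier H" for x using U that by auto
  have eqI: "v = w"
    if "v \<in> carrier K" "w \<in> carrier K" "\<And>z. z \<in> carrier H \<Longrightarrow> ip K v (U z) = ip K w (U z)" for v w
  proof (rule K.eq_if_ip_eq)
    fix z assume "z \<in> carrier K"
    then obtain z' where "z' \<in> carrier H" "z = U z'" using surj by blast
    then show "ip K v z = ip K w z" using that by simp
  qed (use that in auto)
  have "inj_on U (carrier H)"
    using ip by (intro inj_onI H.eq_if_ip_eq) (auto, metis)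
  moreover have "U \<in> bounded_ops H K"
    unfolding bounded_ops_def mem_Collect_eq
  proof (intro conjI ballI allI exI)
    show "U (x \<oplus>\<^bsub>H\<^esub> y) = U x \<oplus>\<^bsub>K\<^esub> U y" if "x \<in> carrier H" "y \<in> carrier H" for x y
      using that carr by (intro eqI) (simp_all add: K.ip_simps H.ip_simps ip)
    show "U (c \<odot>\<^bsub>H\<^esub> x) = c \<odot>\<^bsub>K\<^esub> U x" if "x \<in> carrier H" for c x
      using that carr by (intro eqI) (simp_all add: K.ip_simps H.ip_simps ip)
    show "hnorm K (U x) \<le> 1 * hnorm H x" if "x \<in> carrier H" for x
      using that ip by (simp add: hnorm_def)
  qed (rule U)
  ultimately show ?thesis
    using surj ip by (simp add: unitary_ops_def bij_betw_def)
qed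

lemma unitary_ops_id:
  assumes "inner_product_space H"
  shows "restrict id (carrier H) \<in> unitary_ops H H"
  using assms by (intro unitary_opsI) auto

lemma unitary_ops_compose:
  assumes "inner_product_space H" "inner_product_space L"
    and U: "U \<in> unitary_ops H K" and V: "V \<in> unitary_ops K L"
  shows "compose (carrier H) V U \<in> unitary_ops H L"
proof (rule unitary_opsI)
  show "compose (carrier H) V U ` carrier H = carrier L"
    using bij_betw_compose[OF unitary_ops_bij[OF U] unitary_ops_bij[OF V]]
    by (simp add: bij_betw_def)
qed (use assms in \<open>auto simp: compose_def unitary_ops_carrier unitary_ops_ip\<close>)

lemma unitary_ops_inverse:
  assumes H: "inner_product_space H" and K: "inner_product_space K"
    and U: "U \<in> unitary_ops H K"
  obtains V where "V \<in> unitary_ops K H" "\<And>x. x \<in> carrier H \<Longrightarrow> V (U x) = x"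
proof -
  define V where "V = restrict (inv_into (carrier H) U) (carrier K)"
  have VU: "V (U x) = x" if "x \<in> carrier H" for x
    using that U unitary_ops_bij[OF U] by (simp add: V_def unitary_ops_carrier bij_betw_def)
  have "V \<in> unitary_ops K H"
  proof (rule unitary_opsI[OF K H])
    have "bij_betw V (carrier K) (carrier H)"
      using bij_betw_inv_into[OF unitary_ops_bij[OF U]]
      by (simp add: V_def cong: bij_betw_cong)
    then show "V ` carrier K = carrier H" by (simp add: bij_betw_def)
    then show "V \<in> carrier K \<rightarrow>\<^sub>E carrier H" by (auto simp: V_def)
    fix x y assume "x \<in> carrier K" "y \<in> carrier K"
    then obtain x' y' where "x' \<in> carrier H" "y' \<in> carrier H" "x = U x'" "y = U y'"
      using unitary_ops_ex[OF U] by metis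
    then show "ip H (V x) (V y) = ip K x y" using U by (simp add: VU unitary_ops_ip)
  qed
  with that VU show ?thesis by blast
qed

text \<open>The adjoint of a unitary operator is its inverse, stated along \<open>U\<close> so that no inverse function
  is mentioned.\<close>

lemma adj_unitary:
  assumes H: "inner_product_space H" and U: "U \<in> unitary_ops H K" and x: "x \<in> carrier H"
  shows "adj H K U (U x) = x"
proof -
  interpret inner_product_space H by fact
  have "(THE z. z \<in> carrier H \<and> (\<forall>w\<in>carrier H. ip K (U w) (U x) = ip H w z)) = x"
  proof (rule the_equality)
    fix z assume z: "z \<in> carrier H \<and> (\<forall>w\<in>carrier H. ip K (U w) (U x) = ip H w z)"
    show "z = x"
    proof (rule eq_if_ip_eq)
      fix w assume "w \<in> carrier H"
      then show "ip H z w = ip H x w"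
        using z x U ip_commute[of z w] ip_commute[of x w] by (simp add: unitary_ops_ip)
    qed (use x z in auto)
  qed (use x U in \<open>simp add: unitary_ops_ip\<close>)
  then show ?thesis using x U by (simp add: adj_def unitary_ops_carrier)
qed

lemma conjugate_unitary:
  assumes "inner_product_space H" "U \<in> unitary_ops H K" "x \<in> carrier H"
  shows "conjugate H K U R (U x) = U (R x)"
  using assms by (simp add: conjugate_def compose_def adj_unitary unitary_ops_carrier)

text \<open>The infimum defining the distance ranges over a nonempty set because any two separable
  infinite-dimensional Hilbert spaces are isomorphic: vectors with the same coordinates are
  matched, and the coordinate sequences of either space are all square-summable sequences.\<close>

lemma unitary_ops_nonempty:
  assumes H: "sep_inf_dim_hilbert_space H" and K: "sep_inf_dim_hilbert_space K"
  shows "unitary_ops H K \<noteq> {}"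
proof -
  interpret H: hilbert_space H using H by (simp add: sep_inf_dim_hilbert_space_def)
  interpret K: hilbert_space K using K by (simp add: sep_inf_dim_hilbert_space_def)
  obtain e where e: "H.orthonormal_basis e"
    using H H.ex_orthonormal_basis by (auto simp: sep_inf_dim_hilbert_space_def)
  obtain f where f: "K.orthonormal_basis f"
    using K K.ex_orthonormal_basis by (auto simp: sep_inf_dim_hilbert_space_def)
  have "\<exists>y\<in>carrier K. \<forall>i. ip K y (f i) = ip H x (e i)" if "x \<in> carrier H" for x
    using K.Riesz_Fischer[OF f H.Bessel_summable[OF e that]] by metis
  then obtain g where g: "\<And>x. x \<in> carrier H \<Longrightarrow> g x \<in> carrier K"
    and coord: "\<And>x i. x \<in> carrier H \<Longrightarrow> ip K (g x) (f i) = ip H x (e i)"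
    by metis
  have "restrict g (carrier H) \<in> unitary_ops H K"
  proof (rule unitary_opsI)
    show "restrict g (carrier H) ` carrier H = carrier K"
    proof (intro equalityI subsetI)
      fix y assume y: "y \<in> carrier K"
      obtain x where x: "x \<in> carrier H" "\<And>i. ip H x (e i) = ip K y (f i)"
        using H.Riesz_Fischer[OF e K.Bessel_summable[OF f y]] by metis
      have "g x = y"
        using x y g coord by (intro K.eq_if_coordinates_eq[OF f]) auto
      then show "y \<in> restrict g (carrier H) ` carrier H" using x by auto
    qed (use g in auto)
    fix x y assume xy: "x \<in> carrier H" "y \<in> carrier H"
    have "(\<lambda>i. ip H x (e i) * cnj (ip H y (e i))) sums ip K (g x) (g y)"
      using K.Parseval[OF f g g, OF xy] xy by (simp add: coord)
    then show "ip K (restrict g (carrier H) x) (restrict g (carrier H) y) = ip H x y"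
      using H.Parseval[OF e xy] xy sums_unique2 by fastforce
  qed (use g in \<open>auto intro: H.inner_product_space_axioms K.inner_product_space_axioms\<close>)
  then show ?thesis by blast
qed

section \<open>The defect of a unitary operator\<close>

abbreviation defect ::
    "'a inner_space \<Rightarrow> ('a \<Rightarrow> 'a) \<Rightarrow> 'a inner_space \<Rightarrow> ('a \<Rightarrow> 'a) \<Rightarrow> ('a \<Rightarrow> 'a) \<Rightarrow> real" where
  "defect H R K S U \<equiv> opnorm K K (op_diff K K S (conjugate H K U R))"

text \<open>Since \<open>U\<close> maps the unit ball of \<open>H\<close> onto that of \<open>K\<close>, the supremum may be taken over the
  former, where the adjoint cancels.\<close>

lemma defect_eq_SUP:
  assumes H: "inner_product_space H" and U: "U \<in> unitary_ops H K"
  shows "defect H R K S U =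
    (SUP x\<in>{x \<in> carrier H. hnorm H x \<le> 1}. hnorm K (S (U x) \<ominus>\<^bsub>K\<^esub> U (R x)))"
proof -
  have "{y \<in> carrier K. hnorm K y \<le> 1} = U ` {x \<in> carrier H. hnorm H x \<le> 1}"
  proof (intro equalityI subsetI)
    fix y assume "y \<in> {y \<in> carrier K. hnorm K y \<le> 1}"
    then show "y \<in> U ` {x \<in> carrier H. hnorm H x \<le> 1}"
      using unitary_ops_ex[OF U, of y] unitary_ops_hnorm[OF U] by auto
  qed (use U in \<open>auto simp: unitary_ops_carrier unitary_ops_hnorm\<close>)
  then have "defect H R K S U = (SUP x\<in>{x \<in> carrier H. hnorm H x \<le> 1}.
      hnorm K (op_diff K K S (conjugate H K U R) (U x)))"
    by (simp add: opnorm_def image_image)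
  also have "\<dots> = (SUP x\<in>{x \<in> carrier H. hnorm H x \<le> 1}. hnorm K (S (U x) \<ominus>\<^bsub>K\<^esub> U (R x)))"
    using H U by (intro SUP_cong) (simp_all add: op_diff_def unitary_ops_carrier conjugate_unitary)
  finally show ?thesis .
qed

lemma defect_le:
  assumes H: "inner_product_space H" and U: "U \<in> unitary_ops H K"
    and le: "\<And>x. \<lbrakk>x \<in> carrier H; hnorm H x \<le> 1\<rbrakk> \<Longrightarrow> hnorm K (S (U x) \<ominus>\<^bsub>K\<^esub> U (R x)) \<le> c"
  shows "defect H R K S U \<le> c"
proof -
  interpret inner_product_space H by fact
  have "\<zero>\<^bsub>H\<^esub> \<in> {x \<in> carrier H. hnorm H x \<le> 1}" by simp
  then show ?thesis
    unfolding defect_eq_SUP[OF H U] using le by (intro cSUP_least) auto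
qed

text \<open>Boundedness of \<open>R\<close> and \<open>S\<close> makes the set of values bounded; the supremum of an unbounded
  set of reals would be no upper bound.\<close>

lemma hnorm_le_defect:
  assumes H: "inner_product_space H" and K: "inner_product_space K" and U: "U \<in> unitary_ops H K"
    and R: "R \<in> bounded_ops H H" and S: "S \<in> bounded_ops K K"
    and x: "x \<in> carrier H" "hnorm H x \<le> 1"
  shows "hnorm K (S (U x) \<ominus>\<^bsub>K\<^esub> U (R x)) \<le> defect H R K S U"
proof -
  interpret H: inner_product_space H by fact
  interpret K: inner_product_space K by fact
  note carr = bounded_ops_carrier[OF R] bounded_ops_carrier[OF S] unitary_ops_carrier[OF U]
  obtain C where C: "\<And>x. \<lbrakk>x \<in> carrier H; hnorm H x \<le> 1\<rbrakk> \<Longrightarrow> hnorm H (R x) \<le> C"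
    using bounded_ops_bound[OF R H] by blast
  obtain D where D: "\<And>y. \<lbrakk>y \<in> carrier K; hnorm K y \<le> 1\<rbrakk> \<Longrightarrow> hnorm K (S y) \<le> D"
    using bounded_ops_bound[OF S K] by blast
  have "hnorm K (S (U z) \<ominus>\<^bsub>K\<^esub> U (R z)) \<le> D + C" if z: "z \<in> carrier H" "hnorm H z \<le> 1" for z
  proof -
    have "hnorm K (S (U z) \<ominus>\<^bsub>K\<^esub> U (R z)) \<le>
        hnorm K (S (U z) \<ominus>\<^bsub>K\<^esub> \<zero>\<^bsub>K\<^esub>) + hnorm K (\<zero>\<^bsub>K\<^esub> \<ominus>\<^bsub>K\<^esub> U (R z))"
      using z carr by (intro K.hnorm_triangle_diff) auto
    also have "\<dots> = hnorm K (S (U z)) + hnorm H (R z)"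
      using z carr unitary_ops_hnorm[OF U]
      by (simp add: K.hnorm_diff_commute[of "\<zero>\<^bsub>K\<^esub>"] K.diff_zero)
    also have "\<dots> \<le> D + C"
      using z carr C D unitary_ops_hnorm[OF U] by (intro add_mono) auto
    finally show ?thesis .
  qed
  then have "bdd_above ((\<lambda>x. hnorm K (S (U x) \<ominus>\<^bsub>K\<^esub> U (R x))) ` {x \<in> carrier H. hnorm H x \<le> 1})"
    by (intro bdd_aboveI2) auto
  then show ?thesis
    unfolding defect_eq_SUP[OF H U] using x by (intro cSUP_upper) auto
qed

lemma defect_nonneg:
  assumes H: "inner_product_space H" and K: "inner_product_space K" and U: "U \<in> unitary_ops H K"
    and R: "R \<in> bounded_ops H H" and S: "S \<in> bounded_ops K K"
  shows "0 \<le> defect H R K S U"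
proof -
  interpret H: inner_product_space H by fact
  interpret K: inner_product_space K by fact
  have "0 \<le> hnorm K (S (U \<zero>\<^bsub>H\<^esub>) \<ominus>\<^bsub>K\<^esub> U (R \<zero>\<^bsub>H\<^esub>))"
    using U R S by (intro K.hnorm_nonneg K.M.minus_closed)
      (auto intro!: bounded_ops_carrier[OF R] bounded_ops_carrier[OF S] unitary_ops_carrier[OF U])
  also have "\<dots> \<le> defect H R K S U"
    using assms by (intro hnorm_le_defect) auto
  finally show ?thesis .
qed

lemma defect_eq_0:
  assumes H: "inner_product_space H" and K: "inner_product_space K" and U: "U \<in> unitary_ops H K"
    and R: "R \<in> bounded_ops H H" and S: "S \<in> bounded_ops K K"
    and eq: "\<And>x. x \<in> carrier H \<Longrightarrow> S (U x) = U (R x)"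
  shows "defect H R K S U = 0"
proof (rule antisym)
  interpret K: inner_product_space K by fact
  show "defect H R K S U \<le> 0"
    using bounded_ops_carrier[OF R] unitary_ops_carrier[OF U]
    by (intro defect_le[OF H U]) (simp add: eq)
qed (rule defect_nonneg[OF assms(1-5)])

text \<open>With \<open>y = U x\<close>, the vector \<open>R V y - V S y\<close> is the image under the isometry \<open>V\<close> of
  \<open>U R x - S U x\<close>.\<close>

lemma defect_inverse_le:
  assumes H: "inner_product_space H" and K: "inner_product_space K" and U: "U \<in> unitary_ops H K"
    and R: "R \<in> bounded_ops H H" and S: "S \<in> bounded_ops K K"
    and V: "V \<in> unitary_ops K H" and VU: "\<And>x. x \<in> carrier H \<Longrightarrow> V (U x) = x"
  shows "defect K S H R V \<le> defect H R K S U"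
proof (rule defect_le[OF K V])
  interpret H: inner_product_space H by fact
  interpret K: inner_product_space K by fact
  fix y assume y: "y \<in> carrier K" "hnorm K y \<le> 1"
  then obtain x where x: "x \<in> carrier H" "y = U x" using unitary_ops_ex[OF U] by blast
  note carr = bounded_ops_carrier[OF R] bounded_ops_carrier[OF S] unitary_ops_carrier[OF U]
    unitary_ops_carrier[OF V]
  have "R (V y) \<ominus>\<^bsub>H\<^esub> V (S y) = V (U (R x) \<ominus>\<^bsub>K\<^esub> S (U x))"
    using x carr by (simp add: bounded_ops_diff[OF unitary_ops_bounded[OF V] K H] VU)
  then have "hnorm H (R (V y) \<ominus>\<^bsub>H\<^esub> V (S y)) = hnorm K (S (U x) \<ominus>\<^bsub>K\<^esub> U (R x))"
    using x carr by (simp add: unitary_ops_hnorm[OF V] K.hnorm_diff_commute)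
  also have "\<dots> \<le> defect H R K S U"
    using x y unitary_ops_hnorm[OF U] by (intro hnorm_le_defect[OF H K U R S]) auto
  finally show "hnorm H (R (V y) \<ominus>\<^bsub>H\<^esub> V (S y)) \<le> defect H R K S U" .
qed

text \<open>Inserting the intermediate vector \<open>V S U x\<close> splits the defect of \<open>V U\<close> at \<open>x\<close> into that of \<open>V\<close>
  at \<open>U x\<close> and the isometric image of that of \<open>U\<close> at \<open>x\<close>.\<close>

lemma defect_compose_le:
  assumes H: "inner_product_space H" and K: "inner_product_space K" and L: "inner_product_space L"
    and U: "U \<in> unitary_ops H K" and V: "V \<in> unitary_ops K L"
    and R: "R \<in> bounded_ops H H" and S: "S \<in> bounded_ops K K" and T: "T \<in> bounded_ops L L"
  shows "defect H R L T (compose (carrier H) V U) \<le> defect H R K S U + defect K S L T V"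
proof (rule defect_le[OF H unitary_ops_compose[OF H L U V]])
  interpret H: inner_product_space H by fact
  interpret K: inner_product_space K by fact
  interpret L: inner_product_space L by fact
  fix x assume x: "x \<in> carrier H" "hnorm H x \<le> 1"
  note carr = bounded_ops_carrier[OF R] bounded_ops_carrier[OF S] bounded_ops_carrier[OF T]
    unitary_ops_carrier[OF U] unitary_ops_carrier[OF V]
  have "hnorm L (T (V (U x)) \<ominus>\<^bsub>L\<^esub> V (U (R x))) \<le>
      hnorm L (T (V (U x)) \<ominus>\<^bsub>L\<^esub> V (S (U x))) + hnorm L (V (S (U x)) \<ominus>\<^bsub>L\<^esub> V (U (R x)))"
    using x carr by (intro L.hnorm_triangle_diff) auto
  also have "V (S (U x)) \<ominus>\<^bsub>L\<^esub> V (U (R x)) = V (S (U x) \<ominus>\<^bsub>K\<^esub> U (R x))"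
    using x carr by (simp add: bounded_ops_diff[OF unitary_ops_bounded[OF V] K L])
  also have "hnorm L \<dots> = hnorm K (S (U x) \<ominus>\<^bsub>K\<^esub> U (R x))"
    using x carr by (simp add: unitary_ops_hnorm[OF V])
  also have "hnorm L (T (V (U x)) \<ominus>\<^bsub>L\<^esub> V (S (U x))) + hnorm K (S (U x) \<ominus>\<^bsub>K\<^esub> U (R x)) \<le>
      defect K S L T V + defect H R K S U"
    using x carr unitary_ops_hnorm[OF U]
    by (intro add_mono hnorm_le_defect[OF K L V S T] hnorm_le_defect[OF H K U R S]) auto
  finally show "hnorm L (T (compose (carrier H) V U x) \<ominus>\<^bsub>L\<^esub> compose (carrier H) V U (R x)) \<le>
      defect H R K S U + defect K S L T V"
    using x carr by (simp add: compose_eq)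
qed

section \<open>The pseudometric\<close>

lemma d_uni_le_defect:
  assumes "inner_product_space H" "inner_product_space K" "U \<in> unitary_ops H K"
    and "R \<in> bounded_ops H H" "S \<in> bounded_ops K K"
  shows "d_uni (H, R) (K, S) \<le> defect H R K S U"
  using assms unfolding d_uni.simps
  by (intro cINF_lower bdd_belowI2[where m = 0] defect_nonneg) auto

lemma d_uni_nonneg:
  assumes "inner_product_space H" "inner_product_space K" "unitary_ops H K \<noteq> {}"
    and "R \<in> bounded_ops H H" "S \<in> bounded_ops K K"
  shows "0 \<le> d_uni (H, R) (K, S)"
  using assms unfolding d_uni.simps by (intro cINF_greatest defect_nonneg) auto

lemma d_uni_eq_0_if_unitarily_equivalent:
  assumes H: "inner_product_space H" and K: "inner_product_space K"
    and R: "R \<in> bounded_ops H H" and S: "S \<in> bounded_ops K K"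
    and eq: "unitarily_equivalent (H, R) (K, S)"
  shows "d_uni (H, R) (K, S) = 0"
proof -
  obtain U where U: "U \<in> unitary_ops H K" and "S = conjugate H K U R" using eq by auto
  then have "defect H R K S U = 0"
    using conjugate_unitary[OF H U] by (intro defect_eq_0[OF H K U R S]) simp
  then have "d_uni (H, R) (K, S) \<le> 0"
    using d_uni_le_defect[OF H K U R S] by linarith
  moreover have "0 \<le> d_uni (H, R) (K, S)"
    using U by (intro d_uni_nonneg[OF H K _ R S]) blast
  ultimately show ?thesis by linarith
qed

lemma d_uni_self:
  assumes H: "inner_product_space H" and R: "R \<in> bounded_ops H H"
  shows "d_uni (H, R) (H, R) = 0"
proof (rule d_uni_eq_0_if_unitarily_equivalent[OF H H R R])
  let ?I = "restrict id (carrier H)"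
  have I: "?I \<in> unitary_ops H H" using H by (rule unitary_ops_id)
  have "R = conjugate H H ?I R"
  proof
    fix x
    show "R x = conjugate H H ?I R x"
    proof (cases "x \<in> carrier H")
      case True
      then show ?thesis
        using conjugate_unitary[OF H I True, of R] bounded_ops_carrier[OF R True] by simp
    next
      case False
      have "R \<in> carrier H \<rightarrow>\<^sub>E carrier H"
        using R unfolding bounded_ops_def by blast
      with False have "R x = undefined" by (rule PiE_arb[rotated])
      with False show ?thesis by (simp add: conjugate_def compose_def)
    qed
  qed
  then show "unitarily_equivalent (H, R) (H, R)"
    unfolding unitarily_equivalent.simps using I by (rule bexI)
qed

text \<open>One inequality suffices for symmetry, since the roles of the two operators can be exchanged.\<close>

lemma d_uni_commute_le:
  assumes H: "inner_product_space H" and K: "inner_product_space K" and ne: "unitary_ops H K \<noteq> {}"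
    and R: "R \<in> bounded_ops H H" and S: "S \<in> bounded_ops K K"
  shows "d_uni (K, S) (H, R) \<le> d_uni (H, R) (K, S)"
  unfolding d_uni.simps(1)[of H R K S]
proof (rule cINF_greatest[OF ne])
  fix U assume U: "U \<in> unitary_ops H K"
  obtain V where V: "V \<in> unitary_ops K H" "\<And>x. x \<in> carrier H \<Longrightarrow> V (U x) = x"
    using unitary_ops_inverse[OF H K U] by blast
  show "d_uni (K, S) (H, R) \<le> defect H R K S U"
    using d_uni_le_defect[OF K H V(1) S R] defect_inverse_le[OF H K U R S V] by simp
qed

lemma d_uni_triangle:
  assumes H: "inner_product_space H" and K: "inner_product_space K" and L: "inner_product_space L"
    and ne: "unitary_ops H K \<noteq> {}" "unitary_ops K L \<noteq> {}"
    and R: "R \<in> bounded_ops H H" and S: "S \<in> bounded_ops K K" and T: "T \<in> bounded_ops L L"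
  shows "d_uni (H, R) (L, T) \<le> d_uni (H, R) (K, S) + d_uni (K, S) (L, T)"
proof -
  have *: "d_uni (H, R) (L, T) \<le> defect H R K S U + defect K S L T V"
    if "U \<in> unitary_ops H K" "V \<in> unitary_ops K L" for U V
    using d_uni_le_defect[OF H L unitary_ops_compose[OF H L that] R T]
      defect_compose_le[OF H K L that R S T] by (rule order_trans)
  have "d_uni (H, R) (L, T) - d_uni (H, R) (K, S) \<le> defect K S L T V"
    if V: "V \<in> unitary_ops K L" for V
  proof -
    have "d_uni (H, R) (L, T) - defect K S L T V \<le> d_uni (H, R) (K, S)"
      unfolding d_uni.simps(1)[of H R K S]
    proof (rule cINF_greatest[OF ne(1)])
      show "d_uni (H, R) (L, T) - defect K S L T V \<le> defect H R K S U"
        if "U \<in> unitary_ops H K" for U using *[OF that V] by linarith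
    qed
    then show ?thesis by linarith
  qed
  then have "d_uni (H, R) (L, T) - d_uni (H, R) (K, S) \<le> d_uni (K, S) (L, T)"
    unfolding d_uni.simps(1)[of K S L T] by (rule cINF_greatest[OF ne(2)])
  then show ?thesis by linarith
qed

lemma d_uni_eq_0_iff:
  assumes H: "inner_product_space H" and K: "inner_product_space K" and ne: "unitary_ops H K \<noteq> {}"
    and R: "R \<in> bounded_ops H H" and S: "S \<in> bounded_ops K K"
  shows "d_uni (H, R) (K, S) = 0 \<longleftrightarrow>
    (\<exists>U :: nat \<Rightarrow> 'a \<Rightarrow> 'a. (\<forall>n. U n \<in> unitary_ops H K) \<and> (\<lambda>n. defect H R K S (U n)) \<longlonglongrightarrow> 0)"
    (is "?L \<longleftrightarrow> ?Q")
proof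
  assume ?L
  \<comment> \<open>Otherwise \<open>1 / (n + 1)\<close> would be a positive lower bound of the infimum.\<close>
  have "\<exists>U\<in>unitary_ops H K. defect H R K S U < 1 / real (Suc n)" for n
  proof (rule ccontr)
    assume "\<not> ?thesis"
    then have "1 / real (Suc n) \<le> d_uni (H, R) (K, S)"
      unfolding d_uni.simps by (intro cINF_greatest[OF ne]) force
    moreover have "0 < 1 / real (Suc n)" by simp
    ultimately show False using \<open>?L\<close> by linarith
  qed
  then obtain U where U: "\<And>n. U n \<in> unitary_ops H K"
    and lt: "\<And>n. defect H R K S (U n) < 1 / real (Suc n)" by metis
  have "(\<lambda>n. defect H R K S (U n)) \<longlonglongrightarrow> 0"
  proof (rule tendsto_sandwich[OF _ _ tendsto_const])
    show "\<forall>\<^sub>F n in sequentially. 0 \<le> defect H R K S (U n)"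
      using defect_nonneg[OF H K U R S] by simp
    show "\<forall>\<^sub>F n in sequentially. defect H R K S (U n) \<le> 1 / real (Suc n)"
      using lt by (simp add: less_imp_le)
    show "(\<lambda>n. 1 / real (Suc n)) \<longlonglongrightarrow> 0"
      using LIMSEQ_inverse_real_of_nat by (simp add: inverse_eq_divide)
  qed
  with U show ?Q by blast
next
  assume ?Q
  then obtain U where U: "\<And>n. U n \<in> unitary_ops H K"
    and lim: "(\<lambda>n. defect H R K S (U n)) \<longlonglongrightarrow> 0" by blast
  have "d_uni (H, R) (K, S) \<le> 0"
    using d_uni_le_defect[OF H K U R S] by (intro LIMSEQ_le_const[OF lim]) blast
  with d_uni_nonneg[OF H K ne R S] show ?L by linarith
qed

theorem proposition2p2:
  fixes HS :: "'a inner_space set"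
  assumes "\<And>H. H \<in> HS \<Longrightarrow> sep_inf_dim_hilbert_space H"
  shows "pseudometric_on (B01_all HS) d_uni \<and>
    (\<forall>H R K S. (H, R) \<in> B01_all HS \<longrightarrow> (K, S) \<in> B01_all HS \<longrightarrow>
       (d_uni (H, R) (K, S) = 0 \<longleftrightarrow>
         (\<exists>U :: nat \<Rightarrow> 'a \<Rightarrow> 'a. (\<forall>n. U n \<in> unitary_ops H K) \<and>
            (\<lambda>n. opnorm K K (op_diff K K S (conjugate H K (U n) R))) \<longlonglongrightarrow> 0)) \<and>
       (unitarily_equivalent (H, R) (K, S) \<longrightarrow> d_uni (H, R) (K, S) = 0))"
proof -
  have ips: "inner_product_space H" if "(H, R) \<in> B01_all HS" for H R
    using assms[of H] that
    by (simp add: B01_all_def sep_inf_dim_hilbert_space_def hilbert_space_def)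
  have bdd: "R \<in> bounded_ops H H" if "(H, R) \<in> B01_all HS" for H R
    using that by (simp add: B01_all_def B01_def)
  have ne: "unitary_ops H K \<noteq> {}" if "(H, R) \<in> B01_all HS" "(K, S) \<in> B01_all HS" for H R K S
    using that assms by (intro unitary_ops_nonempty) (auto simp: B01_all_def)
  have "pseudometric_on (B01_all HS) d_uni"
    unfolding pseudometric_on_def
  proof (intro conjI ballI)
    fix p q assume "p \<in> B01_all HS" "q \<in> B01_all HS"
    moreover obtain H R K S where "p = (H, R)" "q = (K, S)" by (metis surj_pair)
    ultimately have HR: "(H, R) \<in> B01_all HS" and KS: "(K, S) \<in> B01_all HS"
      and pq: "p = (H, R)" "q = (K, S)" by auto
    show "0 \<le> d_uni p q"
      unfolding pq by (rule d_uni_nonneg[OF ips[OF HR] ips[OF KS] ne[OF HR KS] bdd[OF HR] bdd[OF KS]])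
    show "d_uni p q = d_uni q p"
      unfolding pq using HR KS by (intro antisym d_uni_commute_le ips bdd ne)
    fix r assume "r \<in> B01_all HS"
    moreover obtain L T where "r = (L, T)" by (metis surj_pair)
    ultimately have LT: "(L, T) \<in> B01_all HS" and r: "r = (L, T)" by auto
    show "d_uni p r \<le> d_uni p q + d_uni q r"
      unfolding pq r using HR KS LT by (intro d_uni_triangle ips bdd ne)
  next
    fix p assume p: "p \<in> B01_all HS"
    obtain H R where "p = (H, R)" by (metis surj_pair)
    with p show "d_uni p p = 0" using d_uni_self ips bdd by blast
  qed
  moreover have "d_uni (H, R) (K, S) = 0 \<longleftrightarrow>
      (\<exists>U :: nat \<Rightarrow> 'a \<Rightarrow> 'a. (\<forall>n. U n \<in> unitary_ops H K) \<and> (\<lambda>n. defect H R K S (U n)) \<longlonglongrightarrow> 0)"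
    if "(H, R) \<in> B01_all HS" "(K, S) \<in> B01_all HS" for H R K S
    using that by (intro d_uni_eq_0_iff ips bdd ne)
  moreover have "d_uni (H, R) (K, S) = 0"
    if "(H, R) \<in> B01_all HS" "(K, S) \<in> B01_all HS" "unitarily_equivalent (H, R) (K, S)" for H R K S
    using that by (intro d_uni_eq_0_if_unitarily_equivalent ips bdd)
  ultimately show ?thesis by blast
qed

end
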